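(* Let $\mathcal{D}$ be the extended Dirac algebra, i.e. the unital associative $\mathbb{R}$-algebra generated by $\gamma^0,\gamma^1,\gamma^2,\gamma^3,i,C$ subject to the relations $\{\gamma^\mu,\gamma^\nu\}=2\eta^{\mu\nu}$ (with $\eta=\mathrm{diag}(1,-1,-1,-1)$), $[i,\gamma^\mu]=0$, $\{C,\gamma^\mu\}=0$, $\{C,i\}=0$, $C^2=1$, $i^2=-1$ for all $\mu,\nu\in\{0,1,2,3\}$. Then $\mathcal{D}$ is isomorphic, as a unital $\mathbb{R}$-algebra, to the Clifford algebra $Cl(3,3)$. More precisely, the six elements $\gamma^1,\gamma^2,\gamma^3,\beta^1,\beta^2,\beta^3$ of $\mathcal{D}$, where $$\beta^1=C,\qquad \beta^2=Ci,\qquad \beta^3=\gamma^5:=-i\gamma^0\gamma^1\gamma^2\gamma^3,$$ are the Clifford algebra generators: the algebra homomorphism from $Cl(3,3)$ to $\mathcal{D}$ sending the three generators of square $+1$ to $\beta^1,\beta^2,\beta^3$ and the three generators of square $-1$ to $\gamma^1,\gamma^2,\gamma^3$ is well defined and is an isomorphism.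
   Context: Notation: $\{a,b\}=ab+ba$ and $[a,b]=ab-ba$. The symbol $i$ denotes a generator of the real algebra $\mathcal{D}$ (representing the complex structure), not a scalar; all algebras are over $\mathbb{R}$. $Cl(3,3)$ is the real unital associative algebra generated by six pairwise anticommuting generators, three of which square to $+1$ and three of which square to $-1$; it has real dimension $2^6$. *)

theory Defs
  imports "HOL-Analysis.Analysis"
begin

text \<open>
  The algebra presented by generators \<open>'g\<close> and relations \<open>R\<close> is the set of formal
  expressions in the generators and the real scalars, modulo the least congruence that contains
  \<open>R\<close> and the axioms of unital associative real algebras. The arithmetic symbols on expressions
  are purely syntactic.
\<close>

datatype 'g alg_term =
    Gen 'g
  | Scal real
  | Sum "'g alg_term" "'g alg_term"
  | Prod "'g alg_term" "'g alg_term"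

instantiation alg_term :: (type) "{zero, one, plus, times, uminus, minus}"
begin
definition "0 = Scal 0"
definition "1 = Scal 1"
definition "a + b = Sum a b"
definition "a * b = Prod a b"
definition "- a = Scal (-1) * (a :: 'a alg_term)"
definition "a - b = a + - (b :: 'a alg_term)"
instance ..
end

inductive pres_eq :: "('g alg_term \<Rightarrow> 'g alg_term \<Rightarrow> bool) \<Rightarrow> 'g alg_term \<Rightarrow> 'g alg_term \<Rightarrow> bool"
  for R where
  rel: "R a b \<Longrightarrow> pres_eq R a b"
| refl: "pres_eq R a a"
| sym: "pres_eq R a b \<Longrightarrow> pres_eq R b a"
| trans: "pres_eq R a b \<Longrightarrow> pres_eq R b c \<Longrightarrow> pres_eq R a c"
| add_cong: "pres_eq R a a' \<Longrightarrow> pres_eq R b b' \<Longrightarrow> pres_eq R (a + b) (a' + b')"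
| mult_cong: "pres_eq R a a' \<Longrightarrow> pres_eq R b b' \<Longrightarrow> pres_eq R (a * b) (a' * b')"
| add_assoc: "pres_eq R ((a + b) + c) (a + (b + c))"
| add_comm: "pres_eq R (a + b) (b + a)"
| add_zero: "pres_eq R (0 + a) a"
| add_neg: "pres_eq R (- a + a) 0"
| mult_assoc: "pres_eq R ((a * b) * c) (a * (b * c))"
| one_mult: "pres_eq R (1 * a) a"
| mult_one: "pres_eq R (a * 1) a"
| distrib_right: "pres_eq R ((a + b) * c) (a * c + b * c)"
| distrib_left: "pres_eq R (a * (b + c)) (a * b + a * c)"
| scal_add: "pres_eq R (Scal (r + s)) (Scal r + Scal s)"
| scal_mult: "pres_eq R (Scal (r * s)) (Scal r * Scal s)"
| scal_central: "pres_eq R (Scal r * a) (a * Scal r)"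

lemma equivp_pres_eq: "equivp (pres_eq R)"
  by (intro equivpI reflpI sympI transpI) (auto intro: pres_eq.intros)

lemma pres_eq_scal_left_comm: "pres_eq R (Scal r * (a * b)) (a * (Scal r * b))"
  by (meson pres_eq.mult_assoc pres_eq.scal_central pres_eq.mult_cong pres_eq.refl
      pres_eq.sym pres_eq.trans)

lemma pres_eq_scal_scal: "pres_eq R (Scal r * (Scal s * a)) (Scal (r * s) * a)"
  by (meson pres_eq.mult_assoc pres_eq.scal_mult pres_eq.mult_cong pres_eq.refl
      pres_eq.sym pres_eq.trans)

lemma pres_eq_scal_distrib: "pres_eq R (Scal (r + s) * a) (Scal r * a + Scal s * a)"
  by (meson pres_eq.scal_add pres_eq.distrib_right pres_eq.mult_cong pres_eq.refl
      pres_eq.trans)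

definition anticommutator :: "'a::{plus,times} \<Rightarrow> 'a \<Rightarrow> 'a" where
  "anticommutator a b = a * b + b * a"

definition commutator :: "'a::{minus,times} \<Rightarrow> 'a \<Rightarrow> 'a" where
  "commutator a b = a * b - b * a"

text \<open>
  Linear representations, needed only to show that the two presented algebras below are nonzero,
  as the class \<^class>\<open>real_algebra_1\<close> requires.
\<close>

primrec alg_act :: "('g \<Rightarrow> 'v \<Rightarrow> 'v) \<Rightarrow> 'g alg_term \<Rightarrow> 'v \<Rightarrow> 'v::real_vector" where
  "alg_act \<rho> (Gen g) = \<rho> g"
| "alg_act \<rho> (Scal r) = (\<lambda>v. r *\<^sub>R v)"
| "alg_act \<rho> (Sum a b) = (\<lambda>v. alg_act \<rho> a v + alg_act \<rho> b v)"
| "alg_act \<rho> (Prod a b) = (\<lambda>v. alg_act \<rho> a (alg_act \<rho> b v))"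

lemma alg_act_simps [simp]:
  "alg_act \<rho> 0 v = 0"
  "alg_act \<rho> 1 v = v"
  "alg_act \<rho> (a + b) v = alg_act \<rho> a v + alg_act \<rho> b v"
  "alg_act \<rho> (a * b) v = alg_act \<rho> a (alg_act \<rho> b v)"
  "alg_act \<rho> (- a) v = - alg_act \<rho> a v"
  "alg_act \<rho> (a - b) v = alg_act \<rho> a v - alg_act \<rho> b v"
  by (simp_all add: zero_alg_term_def one_alg_term_def plus_alg_term_def times_alg_term_def
      uminus_alg_term_def minus_alg_term_def)

lemma linear_alg_act:
  assumes "\<And>g. linear (\<rho> g)"
  shows "linear (alg_act \<rho> a)"
proof (induction a)
  case (Gen g)
  then show ?case using assms by simp
next
  case (Scal r)
  then show ?case by (simp add: linear_iff scaleR_add_right)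
next
  case (Sum a b)
  then show ?case by (simp add: linear_iff scaleR_add_right)
next
  case (Prod a b)
  then show ?case by (simp add: linear_iff)
qed

lemma pres_eq_alg_act:
  assumes "\<And>g. linear (\<rho> g)"
    and "\<And>a b v. R a b \<Longrightarrow> alg_act \<rho> a v = alg_act \<rho> b v"
    and "pres_eq R a b"
  shows "alg_act \<rho> a v = alg_act \<rho> b v"
  using assms(3)
proof (induction arbitrary: v)
  case (rel a b)
  then show ?case using assms(2) by blast
next
  case (distrib_left a b c)
  then show ?case using linear_alg_act[of \<rho>, OF assms(1)] by (simp add: linear_add)
next
  case (scal_central r a)
  then show ?case using linear_alg_act[of \<rho>, OF assms(1)] by (simp add: linear_scale)
qed (simp_all add: scaleR_add_left)

datatype dirac_gen = DGamma 4 | DI | DC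

definition minkowski :: "4 \<Rightarrow> 4 \<Rightarrow> real" where
  "minkowski \<mu> \<nu> = (if \<mu> \<noteq> \<nu> then 0 else if \<mu> = 0 then 1 else -1)"

inductive dirac_rel :: "dirac_gen alg_term \<Rightarrow> dirac_gen alg_term \<Rightarrow> bool" where
  "dirac_rel (anticommutator (Gen (DGamma \<mu>)) (Gen (DGamma \<nu>))) (Scal (2 * minkowski \<mu> \<nu>))"
| "dirac_rel (commutator (Gen DI) (Gen (DGamma \<mu>))) 0"
| "dirac_rel (anticommutator (Gen DC) (Gen (DGamma \<mu>))) 0"
| "dirac_rel (anticommutator (Gen DC) (Gen DI)) 0"
| "dirac_rel (Gen DC * Gen DC) 1"
| "dirac_rel (Gen DI * Gen DI) (- 1)"

quotient_type dirac = "dirac_gen alg_term" / "pres_eq dirac_rel"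
  by (rule equivp_pres_eq)

datatype cl33_gen = CPos 3 | CNeg 3

inductive cl33_rel :: "cl33_gen alg_term \<Rightarrow> cl33_gen alg_term \<Rightarrow> bool" where
  "x \<noteq> y \<Longrightarrow> cl33_rel (anticommutator (Gen x) (Gen y)) 0"
| "cl33_rel (Gen (CPos k) * Gen (CPos k)) 1"
| "cl33_rel (Gen (CNeg k) * Gen (CNeg k)) (- 1)"

quotient_type cl33 = "cl33_gen alg_term" / "pres_eq cl33_rel"
  by (rule equivp_pres_eq)

text \<open>
  Real 8-dimensional representations, as triple tensor products of the 2-by-2 matrices
  \<open>X\<close> (flip), \<open>Z\<close> (sign) and \<open>Z X\<close>. The first three flags say which tensor factors are flipped,
  the last three which ones carry a sign.
\<close>

type_synonym spinor = "real ^ (bool \<times> bool \<times> bool)"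

definition bsign :: "bool \<Rightarrow> bool \<Rightarrow> real" where
  "bsign s a = (if s \<and> a then -1 else 1)"

definition pauli_op ::
  "bool \<Rightarrow> bool \<Rightarrow> bool \<Rightarrow> bool \<Rightarrow> bool \<Rightarrow> bool \<Rightarrow> spinor \<Rightarrow> spinor" where
  "pauli_op x y z s t u v =
    (\<chi> p. case p of (a, b, c) \<Rightarrow>
      bsign s a * bsign t b * bsign u c * v $ (x \<noteq> a, y \<noteq> b, z \<noteq> c))"

lemma linear_pauli_op: "linear (pauli_op x y z s t u)"
  by (simp add: linear_iff vec_eq_iff pauli_op_def algebra_simps split: prod.splits)

abbreviation "pos1 \<equiv> pauli_op True False False False False False"
abbreviation "neg1 \<equiv> pauli_op True False False True False False"
abbreviation "pos2 \<equiv> pauli_op False True False True False False"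
abbreviation "neg2 \<equiv> pauli_op False True False True True False"
abbreviation "pos3 \<equiv> pauli_op False False True True True False"
abbreviation "neg3 \<equiv> pauli_op False False True True True True"
abbreviation "chir \<equiv> pauli_op False False False True True True"

primrec cl33_rep :: "cl33_gen \<Rightarrow> spinor \<Rightarrow> spinor" where
  "cl33_rep (CPos k) = (if k = 1 then pos1 else if k = 2 then pos2 else pos3)"
| "cl33_rep (CNeg k) = (if k = 1 then neg1 else if k = 2 then neg2 else neg3)"

primrec dirac_rep :: "dirac_gen \<Rightarrow> spinor \<Rightarrow> spinor" where
  "dirac_rep (DGamma \<mu>) =
    (if \<mu> = 0 then chir else if \<mu> = 1 then neg1 else if \<mu> = 2 then neg2 else neg3)"
| "dirac_rep DI = (\<lambda>v. pos1 (pos2 v))"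
| "dirac_rep DC = pos1"

lemma linear_cl33_rep: "linear (cl33_rep g)"
  by (cases g) (simp_all add: linear_pauli_op)

lemma linear_dirac_rep: "linear (dirac_rep g)"
  using linear_compose[OF linear_pauli_op linear_pauli_op]
  by (cases g) (simp_all add: linear_pauli_op comp_def)

lemma exhaust_4_zero: "(\<mu>::4) = 0 \<or> \<mu> = 1 \<or> \<mu> = 2 \<or> \<mu> = 3"
  using exhaust_4[of \<mu>] by auto

lemma dirac_rel_rep: "dirac_rel a b \<Longrightarrow> alg_act dirac_rep a v = alg_act dirac_rep b v"
proof (induction rule: dirac_rel.induct)
  case (1 \<mu> \<nu>)
  show ?case
    using exhaust_4_zero[of \<mu>] exhaust_4_zero[of \<nu>]
    by (elim disjE) (simp_all add: anticommutator_def minkowski_def vec_eq_iff pauli_op_def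
        bsign_def)
next
  case (2 \<mu>)
  show ?case
    using exhaust_4_zero[of \<mu>]
    by (elim disjE) (simp_all add: commutator_def vec_eq_iff pauli_op_def bsign_def)
next
  case (3 \<mu>)
  show ?case
    using exhaust_4_zero[of \<mu>]
    by (elim disjE) (simp_all add: anticommutator_def vec_eq_iff pauli_op_def bsign_def)
qed (simp_all add: anticommutator_def vec_eq_iff pauli_op_def bsign_def)

lemma cl33_rel_rep: "cl33_rel a b \<Longrightarrow> alg_act cl33_rep a v = alg_act cl33_rep b v"
proof (induction rule: cl33_rel.induct)
  case (1 x y)
  have *: "g \<in> {CPos 1, CPos 2, CPos 3, CNeg 1, CNeg 2, CNeg 3}" for g
    using exhaust_3 by (cases g) auto
  show ?case
    using *[of x] *[of y] 1
    by (elim insertE) (simp_all add: anticommutator_def vec_eq_iff pauli_op_def bsign_def)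
next
  case (2 k)
  show ?case
    using exhaust_3[of k] by (elim disjE) (simp_all add: vec_eq_iff pauli_op_def bsign_def)
next
  case (3 k)
  show ?case
    using exhaust_3[of k] by (elim disjE) (simp_all add: vec_eq_iff pauli_op_def bsign_def)
qed

lemma not_pres_eq_dirac_0_1: "\<not> pres_eq dirac_rel 0 1"
proof
  assume "pres_eq dirac_rel 0 1"
  then have "alg_act dirac_rep 0 v = alg_act dirac_rep 1 v" for v
    using pres_eq_alg_act[of dirac_rep dirac_rel] linear_dirac_rep dirac_rel_rep by blast
  from this[of "\<chi> i. 1"] show False by (simp add: vec_eq_iff)
qed

lemma not_pres_eq_cl33_0_1: "\<not> pres_eq cl33_rel 0 1"
proof
  assume "pres_eq cl33_rel 0 1"
  then have "alg_act cl33_rep 0 v = alg_act cl33_rep 1 v" for v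
    using pres_eq_alg_act[of cl33_rep cl33_rel] linear_cl33_rep cl33_rel_rep by blast
  from this[of "\<chi> i. 1"] show False by (simp add: vec_eq_iff)
qed

instantiation dirac :: real_algebra_1
begin
lift_definition zero_dirac :: dirac is 0 .
lift_definition one_dirac :: dirac is 1 .
lift_definition plus_dirac :: "dirac \<Rightarrow> dirac \<Rightarrow> dirac" is "(+)" by (rule pres_eq.add_cong)
lift_definition times_dirac :: "dirac \<Rightarrow> dirac \<Rightarrow> dirac" is "(*)" by (rule pres_eq.mult_cong)
lift_definition uminus_dirac :: "dirac \<Rightarrow> dirac" is uminus
  unfolding uminus_alg_term_def by (intro pres_eq.mult_cong pres_eq.refl)
lift_definition minus_dirac :: "dirac \<Rightarrow> dirac \<Rightarrow> dirac" is "(-)"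
  unfolding uminus_alg_term_def minus_alg_term_def
  by (intro pres_eq.add_cong pres_eq.mult_cong pres_eq.refl)
lift_definition scaleR_dirac :: "real \<Rightarrow> dirac \<Rightarrow> dirac" is "\<lambda>r a. Scal r * a"
  by (intro pres_eq.mult_cong pres_eq.refl)
instance
proof
  fix a b c :: dirac and r s :: real
  show "a + b + c = a + (b + c)" by transfer (rule pres_eq.add_assoc)
  show "a + b = b + a" by transfer (rule pres_eq.add_comm)
  show "0 + a = a" by transfer (rule pres_eq.add_zero)
  show "- a + a = 0" by transfer (rule pres_eq.add_neg)
  show "a - b = a + - b" by transfer (simp add: minus_alg_term_def pres_eq.refl)
  show "a * b * c = a * (b * c)" by transfer (rule pres_eq.mult_assoc)
  show "1 * a = a" by transfer (rule pres_eq.one_mult)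
  show "a * 1 = a" by transfer (rule pres_eq.mult_one)
  show "(a + b) * c = a * c + b * c" by transfer (rule pres_eq.distrib_right)
  show "a * (b + c) = a * b + a * c" by transfer (rule pres_eq.distrib_left)
  show "(0::dirac) \<noteq> 1" by transfer (rule not_pres_eq_dirac_0_1)
  show "r *\<^sub>R (a + b) = r *\<^sub>R a + r *\<^sub>R b" by transfer (rule pres_eq.distrib_left)
  show "(r + s) *\<^sub>R a = r *\<^sub>R a + s *\<^sub>R a" by transfer (rule pres_eq_scal_distrib)
  show "r *\<^sub>R s *\<^sub>R a = (r * s) *\<^sub>R a" by transfer (rule pres_eq_scal_scal)
  show "1 *\<^sub>R a = a" by transfer (rule pres_eq.one_mult[unfolded one_alg_term_def])
  show "r *\<^sub>R a * b = r *\<^sub>R (a * b)" by transfer (rule pres_eq.mult_assoc)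
  show "a * r *\<^sub>R b = r *\<^sub>R (a * b)"
    by transfer (rule pres_eq.sym[OF pres_eq_scal_left_comm])
qed
end

instantiation cl33 :: real_algebra_1
begin
lift_definition zero_cl33 :: cl33 is 0 .
lift_definition one_cl33 :: cl33 is 1 .
lift_definition plus_cl33 :: "cl33 \<Rightarrow> cl33 \<Rightarrow> cl33" is "(+)" by (rule pres_eq.add_cong)
lift_definition times_cl33 :: "cl33 \<Rightarrow> cl33 \<Rightarrow> cl33" is "(*)" by (rule pres_eq.mult_cong)
lift_definition uminus_cl33 :: "cl33 \<Rightarrow> cl33" is uminus
  unfolding uminus_alg_term_def by (intro pres_eq.mult_cong pres_eq.refl)
lift_definition minus_cl33 :: "cl33 \<Rightarrow> cl33 \<Rightarrow> cl33" is "(-)"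
  unfolding uminus_alg_term_def minus_alg_term_def
  by (intro pres_eq.add_cong pres_eq.mult_cong pres_eq.refl)
lift_definition scaleR_cl33 :: "real \<Rightarrow> cl33 \<Rightarrow> cl33" is "\<lambda>r a. Scal r * a"
  by (intro pres_eq.mult_cong pres_eq.refl)
instance
proof
  fix a b c :: cl33 and r s :: real
  show "a + b + c = a + (b + c)" by transfer (rule pres_eq.add_assoc)
  show "a + b = b + a" by transfer (rule pres_eq.add_comm)
  show "0 + a = a" by transfer (rule pres_eq.add_zero)
  show "- a + a = 0" by transfer (rule pres_eq.add_neg)
  show "a - b = a + - b" by transfer (simp add: minus_alg_term_def pres_eq.refl)
  show "a * b * c = a * (b * c)" by transfer (rule pres_eq.mult_assoc)
  show "1 * a = a" by transfer (rule pres_eq.one_mult)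
  show "a * 1 = a" by transfer (rule pres_eq.mult_one)
  show "(a + b) * c = a * c + b * c" by transfer (rule pres_eq.distrib_right)
  show "a * (b + c) = a * b + a * c" by transfer (rule pres_eq.distrib_left)
  show "(0::cl33) \<noteq> 1" by transfer (rule not_pres_eq_cl33_0_1)
  show "r *\<^sub>R (a + b) = r *\<^sub>R a + r *\<^sub>R b" by transfer (rule pres_eq.distrib_left)
  show "(r + s) *\<^sub>R a = r *\<^sub>R a + s *\<^sub>R a" by transfer (rule pres_eq_scal_distrib)
  show "r *\<^sub>R s *\<^sub>R a = (r * s) *\<^sub>R a" by transfer (rule pres_eq_scal_scal)
  show "1 *\<^sub>R a = a" by transfer (rule pres_eq.one_mult[unfolded one_alg_term_def])
  show "r *\<^sub>R a * b = r *\<^sub>R (a * b)" by transfer (rule pres_eq.mult_assoc)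
  show "a * r *\<^sub>R b = r *\<^sub>R (a * b)"
    by transfer (rule pres_eq.sym[OF pres_eq_scal_left_comm])
qed
end

lift_definition gamma :: "4 \<Rightarrow> dirac" is "\<lambda>\<mu>. Gen (DGamma \<mu>)" .
lift_definition dirac_i :: dirac is "Gen DI" .
lift_definition dirac_C :: dirac is "Gen DC" .

text \<open>The index type \<^typ>\<open>3\<close> consists of \<open>1\<close>, \<open>2\<close> and \<open>3 = 0\<close>.\<close>

lift_definition cl33_pos :: "3 \<Rightarrow> cl33" is "\<lambda>k. Gen (CPos k)" .
lift_definition cl33_neg :: "3 \<Rightarrow> cl33" is "\<lambda>k. Gen (CNeg k)" .

definition gamma5 :: dirac where
  "gamma5 = - dirac_i * gamma 0 * gamma 1 * gamma 2 * gamma 3"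

definition beta1 :: dirac where "beta1 = dirac_C"
definition beta2 :: dirac where "beta2 = dirac_C * dirac_i"
definition beta3 :: dirac where "beta3 = gamma5"

definition real_algebra_hom :: "('a::real_algebra_1 \<Rightarrow> 'b::real_algebra_1) \<Rightarrow> bool" where
  "real_algebra_hom f \<longleftrightarrow> linear f \<and> f 1 = 1 \<and> (\<forall>x y. f (x * y) = f x * f y)"

definition real_algebra_iso :: "('a::real_algebra_1 \<Rightarrow> 'b::real_algebra_1) \<Rightarrow> bool" where
  "real_algebra_iso f \<longleftrightarrow> real_algebra_hom f \<and> bij f"

definition clifford_gens_map :: "(cl33 \<Rightarrow> dirac) \<Rightarrow> bool" where
  "clifford_gens_map f \<longleftrightarrow>
    f (cl33_pos 1) = beta1 \<and> f (cl33_pos 2) = beta2 \<and> f (cl33_pos 3) = beta3 \<and>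
    f (cl33_neg 1) = gamma 1 \<and> f (cl33_neg 2) = gamma 2 \<and> f (cl33_neg 3) = gamma 3"

end

theory Submission
  imports Defs
begin

text \<open>
  Since \<open>i = \<beta>\<^sup>1 \<beta>\<^sup>2\<close>, the definition of \<open>\<gamma>\<^sup>5\<close> can be solved for \<open>\<gamma>\<^sup>0\<close>, which
  turns out to be the pseudoscalar \<open>\<beta>\<^sup>1 \<beta>\<^sup>2 \<beta>\<^sup>3 \<gamma>\<^sup>1 \<gamma>\<^sup>2 \<gamma>\<^sup>3\<close>. So each of the two families of
  generators can be expressed by the other, and each satisfies the relations of the other algebra.
  By the universal property of a presentation this gives homomorphisms in both directions, which
  are mutually inverse because they are so on generators.
\<close>

section \<open>Evaluation of expressions and homomorphisms out of a quotient\<close>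

primrec alg_eval :: "('g \<Rightarrow> 'a) \<Rightarrow> 'g alg_term \<Rightarrow> 'a::real_algebra_1" where
  "alg_eval h (Gen g) = h g"
| "alg_eval h (Scal r) = r *\<^sub>R 1"
| "alg_eval h (Sum a b) = alg_eval h a + alg_eval h b"
| "alg_eval h (Prod a b) = alg_eval h a * alg_eval h b"

lemma alg_eval_simps [simp]:
  "alg_eval h 0 = 0"
  "alg_eval h 1 = 1"
  "alg_eval h (a + b) = alg_eval h a + alg_eval h b"
  "alg_eval h (a * b) = alg_eval h a * alg_eval h b"
  "alg_eval h (- a) = - alg_eval h a"
  "alg_eval h (a - b) = alg_eval h a - alg_eval h b"
  by (simp_all add: zero_alg_term_def one_alg_term_def plus_alg_term_def times_alg_term_def
      uminus_alg_term_def minus_alg_term_def)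

text \<open>Apart from \<open>rel\<close>, every rule of \<open>pres_eq\<close> is an equivalence or
  congruence rule or a law valid in all real algebras, so only the relations need checking in the
  target.\<close>

lemma pres_eq_alg_eval:
  assumes "\<And>a b. R a b \<Longrightarrow> alg_eval h a = alg_eval h b"
    and "pres_eq R a b"
  shows "alg_eval h a = alg_eval h b"
  using assms(2) by induction (simp_all add: assms(1) algebra_simps)

text \<open>Surjectivity lets every element be written as a class \<open>abs t\<close>, where
  \<open>f\<close> is just evaluation. The projection \<open>abs\<close> is kept generic so that one
  argument serves both quotients.\<close>

lemma hom_of_quotient:
  fixes abs :: "'g alg_term \<Rightarrow> 'a::real_algebra_1" and f :: "'a \<Rightarrow> 'b::real_algebra_1"
  assumes "surj abs"
    and "\<And>a b. abs (a + b) = abs a + abs b" "\<And>a b. abs (a * b) = abs a * abs b"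
    and "\<And>r. abs (Scal r) = r *\<^sub>R 1"
    and "\<And>t. f (abs t) = alg_eval h t"
  shows "real_algebra_hom f"
proof -
  have add: "f (x + y) = f x + f y" for x y
    using surjD[OF assms(1), of x] surjD[OF assms(1), of y]
    by (metis assms(2) assms(5) alg_eval_simps(3))
  have mult: "f (x * y) = f x * f y" for x y
    using surjD[OF assms(1), of x] surjD[OF assms(1), of y]
    by (metis assms(3) assms(5) alg_eval_simps(4))
  have scal: "f (r *\<^sub>R 1) = r *\<^sub>R 1" for r
    by (metis assms(4) assms(5) alg_eval.simps(2))
  \<comment> \<open>Scaling by \<open>r\<close> is multiplication by \<open>r *\<^sub>R 1\<close>,
    so homogeneity follows from multiplicativity.\<close>
  have "f (r *\<^sub>R x) = r *\<^sub>R f x" for r x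
    using mult[of "r *\<^sub>R 1" x] by (simp add: scal)
  then show ?thesis
    using add mult scal[of 1] by (simp add: real_algebra_hom_def linear_iff)
qed

text \<open>Each class has a representative built from generators and scalars, and agreement on
  generators propagates through it by induction.\<close>

lemma hom_quotient_unique:
  fixes abs :: "'g alg_term \<Rightarrow> 'a::real_algebra_1" and f f' :: "'a \<Rightarrow> 'b::real_algebra_1"
  assumes "surj abs"
    and "\<And>a b. abs (a + b) = abs a + abs b" "\<And>a b. abs (a * b) = abs a * abs b"
    and "\<And>r. abs (Scal r) = r *\<^sub>R 1"
    and "real_algebra_hom f" "real_algebra_hom f'"
    and "\<And>g. f (abs (Gen g)) = f' (abs (Gen g))"
  shows "f = f'"
proof
  have "f (abs t) = f' (abs t)" for t
    using assms(5,6)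
    by (induction t)
      (simp_all add: assms real_algebra_hom_def linear_add linear_scale
        flip: plus_alg_term_def times_alg_term_def)
  then show "f x = f' x" for x
    using surjD[OF assms(1), of x] by metis
qed

lemma real_algebra_hom_compose:
  "real_algebra_hom f \<Longrightarrow> real_algebra_hom g \<Longrightarrow> real_algebra_hom (\<lambda>x. g (f x))"
  by (simp add: real_algebra_hom_def linear_iff)

lemma real_algebra_hom_id: "real_algebra_hom (\<lambda>x. x)"
  by (simp add: real_algebra_hom_def linear_iff)

lemma real_algebra_homD:
  assumes "real_algebra_hom f"
  shows "f 1 = 1" "f (x * y) = f x * f y" "f (- x) = - f x"
  using assms by (simp_all add: real_algebra_hom_def linear_neg)

section \<open>Universal properties of the two presented algebras\<close>

lemma surj_abs_cl33: "surj abs_cl33"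
  by (metis Quotient3_abs_rep Quotient3_cl33 surjI)

lemma surj_abs_dirac: "surj abs_dirac"
  by (metis Quotient3_abs_rep Quotient3_dirac surjI)

text \<open>The right side is by definition the class of \<open>Scal r * 1\<close>, which the unit
  law identifies with that of \<open>Scal r\<close>.\<close>

lemma abs_cl33_scal: "abs_cl33 (Scal r) = r *\<^sub>R 1"
  unfolding one_cl33.abs_eq scaleR_cl33.abs_eq
  by (simp add: cl33.abs_eq_iff pres_eq.mult_one pres_eq.sym)

lemma abs_dirac_scal: "abs_dirac (Scal r) = r *\<^sub>R 1"
  unfolding one_dirac.abs_eq scaleR_dirac.abs_eq
  by (simp add: dirac.abs_eq_iff pres_eq.mult_one pres_eq.sym)

lemmas cl33_quotient =
  surj_abs_cl33 plus_cl33.abs_eq[symmetric] times_cl33.abs_eq[symmetric] abs_cl33_scal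
lemmas dirac_quotient =
  surj_abs_dirac plus_dirac.abs_eq[symmetric] times_dirac.abs_eq[symmetric] abs_dirac_scal

text \<open>A class is evaluated at its chosen representative; the choice does not matter because
  \<open>h\<close> respects the relations.\<close>

lemma cl33_hom_exists:
  assumes "\<And>a b. cl33_rel a b \<Longrightarrow> alg_eval h a = alg_eval h b"
  obtains f where "real_algebra_hom f" "\<And>g. f (abs_cl33 (Gen g)) = h g"
proof -
  define f where "f x = alg_eval h (rep_cl33 x)" for x
  have f: "f (abs_cl33 t) = alg_eval h t" for t
    unfolding f_def
    by (rule pres_eq_alg_eval[where R = cl33_rel])
      (simp_all add: assms Quotient3_rep_abs[OF Quotient3_cl33] pres_eq.refl)
  show thesis
    using that[of f] hom_of_quotient[OF cl33_quotient, of f h] f by simp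
qed

lemma dirac_hom_exists:
  assumes "\<And>a b. dirac_rel a b \<Longrightarrow> alg_eval h a = alg_eval h b"
  obtains f where "real_algebra_hom f" "\<And>g. f (abs_dirac (Gen g)) = h g"
proof -
  define f where "f x = alg_eval h (rep_dirac x)" for x
  have f: "f (abs_dirac t) = alg_eval h t" for t
    unfolding f_def
    by (rule pres_eq_alg_eval[where R = dirac_rel])
      (simp_all add: assms Quotient3_rep_abs[OF Quotient3_dirac] pres_eq.refl)
  show thesis
    using that[of f] hom_of_quotient[OF dirac_quotient, of f h] f by simp
qed

lemma cl33_gen_cases:
  "g = CPos 1 \<or> g = CPos 2 \<or> g = CPos 3 \<or> g = CNeg 1 \<or> g = CNeg 2 \<or> g = CNeg 3"
  using exhaust_3 by (cases g) auto

lemma dirac_gen_cases: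
  "g = DGamma 0 \<or> g = DGamma 1 \<or> g = DGamma 2 \<or> g = DGamma 3 \<or> g = DI \<or> g = DC"
  using exhaust_4_zero by (cases g) auto

lemma cl33_hom_unique:
  assumes "real_algebra_hom f" "real_algebra_hom f'"
    and "f (cl33_pos 1) = f' (cl33_pos 1)" "f (cl33_pos 2) = f' (cl33_pos 2)"
      "f (cl33_pos 3) = f' (cl33_pos 3)" "f (cl33_neg 1) = f' (cl33_neg 1)"
      "f (cl33_neg 2) = f' (cl33_neg 2)" "f (cl33_neg 3) = f' (cl33_neg 3)"
  shows "f = f'"
proof (rule hom_quotient_unique[OF cl33_quotient assms(1,2)])
  show "f (abs_cl33 (Gen g)) = f' (abs_cl33 (Gen g))" for g
    using cl33_gen_cases[of g] assms(3-)
    by (auto simp: cl33_pos.abs_eq cl33_neg.abs_eq)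
qed

lemma dirac_hom_unique:
  assumes "real_algebra_hom f" "real_algebra_hom f'"
    and "f (gamma 0) = f' (gamma 0)" "f (gamma 1) = f' (gamma 1)"
      "f (gamma 2) = f' (gamma 2)" "f (gamma 3) = f' (gamma 3)"
      "f dirac_i = f' dirac_i" "f dirac_C = f' dirac_C"
  shows "f = f'"
proof (rule hom_quotient_unique[OF dirac_quotient assms(1,2)])
  show "f (abs_dirac (Gen g)) = f' (abs_dirac (Gen g))" for g
    using dirac_gen_cases[of g] assms(3-)
    by (auto simp: gamma.abs_eq dirac_i.abs_eq dirac_C.abs_eq)
qed

section \<open>Relations between generators as rewrite rules\<close>

lemma cl33_relations:
  "cl33_pos k * cl33_pos k = 1"
  "cl33_neg k * cl33_neg k = - 1"
  "k \<noteq> l \<Longrightarrow> cl33_pos k * cl33_pos l = - (cl33_pos l * cl33_pos k)"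
  "k \<noteq> l \<Longrightarrow> cl33_neg k * cl33_neg l = - (cl33_neg l * cl33_neg k)"
  "cl33_neg k * cl33_pos l = - (cl33_pos l * cl33_neg k)"
  subgoal by transfer (intro pres_eq.rel cl33_rel.intros)
  subgoal by transfer (intro pres_eq.rel cl33_rel.intros)
  subgoal
    unfolding eq_neg_iff_add_eq_0
    by transfer (intro pres_eq.rel cl33_rel.intros(1)[unfolded anticommutator_def]; simp)
  subgoal
    unfolding eq_neg_iff_add_eq_0
    by transfer (intro pres_eq.rel cl33_rel.intros(1)[unfolded anticommutator_def]; simp)
  subgoal
    unfolding eq_neg_iff_add_eq_0
    by transfer (intro pres_eq.rel cl33_rel.intros(1)[unfolded anticommutator_def]; simp)
  done

lemma gamma_anticommutator:
  "gamma \<mu> * gamma \<nu> + gamma \<nu> * gamma \<mu> = (2 * minkowski \<mu> \<nu>) *\<^sub>R 1"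
  unfolding abs_dirac_scal[symmetric] gamma.abs_eq times_dirac.abs_eq plus_dirac.abs_eq
    dirac.abs_eq_iff
  by (intro pres_eq.rel dirac_rel.intros(1)[unfolded anticommutator_def])

lemma dirac_relations:
  "gamma 0 * gamma 0 = 1"
  "\<mu> \<noteq> 0 \<Longrightarrow> gamma \<mu> * gamma \<mu> = - 1"
  "\<mu> \<noteq> \<nu> \<Longrightarrow> gamma \<mu> * gamma \<nu> = - (gamma \<nu> * gamma \<mu>)"
  "gamma \<mu> * dirac_i = dirac_i * gamma \<mu>"
  "gamma \<mu> * dirac_C = - (dirac_C * gamma \<mu>)"
  "dirac_i * dirac_C = - (dirac_C * dirac_i)"
  "dirac_C * dirac_C = 1"
  "dirac_i * dirac_i = - 1"
proof -
  have square: "gamma \<nu> * gamma \<nu> = minkowski \<nu> \<nu> *\<^sub>R 1" for \<nu>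
  proof -
    \<comment> \<open>The anticommutator of a generator with itself is twice its square; the factor
      2 is then cancelled.\<close>
    have "(2::real) *\<^sub>R (gamma \<nu> * gamma \<nu>) = 2 *\<^sub>R (minkowski \<nu> \<nu> *\<^sub>R 1)"
      using gamma_anticommutator[of \<nu> \<nu>] by (simp add: scaleR_2)
    then show ?thesis by (simp only: scaleR_cancel_left) simp
  qed
  show "gamma 0 * gamma 0 = 1" "\<mu> \<noteq> 0 \<Longrightarrow> gamma \<mu> * gamma \<mu> = - 1"
    by (simp_all add: square minkowski_def)
  show "\<mu> \<noteq> \<nu> \<Longrightarrow> gamma \<mu> * gamma \<nu> = - (gamma \<nu> * gamma \<mu>)"
    using gamma_anticommutator[of \<mu> \<nu>] by (simp add: minkowski_def eq_neg_iff_add_eq_0)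
  have "dirac_i * gamma \<mu> - gamma \<mu> * dirac_i = 0"
    by transfer (intro pres_eq.rel dirac_rel.intros(2)[unfolded commutator_def])
  then show "gamma \<mu> * dirac_i = dirac_i * gamma \<mu>" by simp
  have "dirac_C * gamma \<mu> + gamma \<mu> * dirac_C = 0"
    by transfer (intro pres_eq.rel dirac_rel.intros(3)[unfolded anticommutator_def])
  then show "gamma \<mu> * dirac_C = - (dirac_C * gamma \<mu>)"
    by (simp add: eq_neg_iff_add_eq_0 add.commute)
  have "dirac_C * dirac_i + dirac_i * dirac_C = 0"
    by transfer (intro pres_eq.rel dirac_rel.intros(4)[unfolded anticommutator_def])
  then show "dirac_i * dirac_C = - (dirac_C * dirac_i)"
    by (simp add: eq_neg_iff_add_eq_0 add.commute)
  show "dirac_C * dirac_C = 1" "dirac_i * dirac_i = - 1"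
    by (transfer, intro pres_eq.rel dirac_rel.intros)+
qed

text \<open>Lets a rule for two adjacent generators apply inside the right-nested products produced
  by \<open>mult.assoc\<close>.\<close>

lemma mult_eq_left_assoc:
  fixes a b c d :: "'a::semigroup_mult"
  shows "a * b = c \<Longrightarrow> a * (b * d) = c * d"
  by (simp flip: mult.assoc)

text \<open>
  Rewriting with the following two collections brings every monomial into a normal form, with the
  generators in the order \<open>p\<^sub>1 p\<^sub>2 p\<^sub>3 n\<^sub>1 n\<^sub>2 n\<^sub>3\<close> respectively
  \<open>C i \<gamma>\<^sup>0 \<gamma>\<^sup>1 \<gamma>\<^sup>2 \<gamma>\<^sup>3\<close>.
\<close>

lemmas cl33_sort =
  cl33_relations(1,2,5)
  cl33_relations(3)[of 2 1, simplified] cl33_relations(3)[of 3 1, simplified]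
  cl33_relations(3)[of 3 2, simplified]
  cl33_relations(4)[of 2 1, simplified] cl33_relations(4)[of 3 1, simplified]
  cl33_relations(4)[of 3 2, simplified]

lemmas dirac_sort =
  dirac_relations(1,4-8)
  dirac_relations(2)[of 1, simplified] dirac_relations(2)[of 2, simplified]
  dirac_relations(2)[of 3, simplified]
  dirac_relations(3)[of 1 0, simplified] dirac_relations(3)[of 2 0, simplified]
  dirac_relations(3)[of 3 0, simplified] dirac_relations(3)[of 2 1, simplified]
  dirac_relations(3)[of 3 1, simplified] dirac_relations(3)[of 3 2, simplified]

lemmas cl33_normalize = mult.assoc cl33_sort cl33_sort[THEN mult_eq_left_assoc]
lemmas dirac_normalize = mult.assoc dirac_sort dirac_sort[THEN mult_eq_left_assoc]

section \<open>Each family of generators inside the other algebra\<close>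

primrec cl33_image :: "cl33_gen \<Rightarrow> dirac" where
  "cl33_image (CPos k) = (if k = 1 then beta1 else if k = 2 then beta2 else beta3)"
| "cl33_image (CNeg k) = (if k = 1 then gamma 1 else if k = 2 then gamma 2 else gamma 3)"

text \<open>The value for \<open>\<gamma>\<^sup>0\<close> is the right one because
  \<open>\<gamma>\<^sup>1 \<gamma>\<^sup>2 \<gamma>\<^sup>3\<close> has square 1 and
  \<open>i \<gamma>\<^sup>5\<close> equals \<open>\<gamma>\<^sup>0 \<gamma>\<^sup>1 \<gamma>\<^sup>2
  \<gamma>\<^sup>3\<close>.\<close>

primrec dirac_image :: "dirac_gen \<Rightarrow> cl33" where
  "dirac_image (DGamma \<mu>) =
    (if \<mu> = 0 then
      cl33_pos 1 * cl33_pos 2 * cl33_pos 3 * cl33_neg 1 * cl33_neg 2 * cl33_neg 3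
     else if \<mu> = 1 then cl33_neg 1 else if \<mu> = 2 then cl33_neg 2 else cl33_neg 3)"
| "dirac_image DI = cl33_pos 1 * cl33_pos 2"
| "dirac_image DC = cl33_pos 1"

lemmas beta_defs = beta1_def beta2_def beta3_def gamma5_def

text \<open>A finite check by normal forms. For instance, \<open>C i\<close> squares to 1 since
  moving \<open>i\<close> past \<open>C\<close> costs a sign, and \<open>C\<close> anticommutes with
  \<open>\<gamma>\<^sup>5\<close> since it passes five factors.\<close>

lemma cl33_image_rel: "cl33_rel a b \<Longrightarrow> alg_eval cl33_image a = alg_eval cl33_image b"
proof (induction rule: cl33_rel.induct)
  case (1 x y)
  then show ?case
    using cl33_gen_cases[of x] cl33_gen_cases[of y]
    by (elim disjE) (simp_all add: anticommutator_def beta_defs dirac_normalize)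
next
  case (2 k)
  show ?case
    using exhaust_3[of k] by (elim disjE) (simp_all add: beta_defs dirac_normalize)
next
  case (3 k)
  show ?case
    using exhaust_3[of k] by (elim disjE) (simp_all add: dirac_normalize)
qed

text \<open>The product of all six generators passes five signs at each of them, hence anticommutes
  with each and commutes with \<open>p\<^sub>1 p\<^sub>2\<close>. Its square is (-1)^15 (-1)^3 = 1,
  as required of \<open>\<gamma>\<^sup>0\<close>.\<close>

lemma dirac_image_rel: "dirac_rel a b \<Longrightarrow> alg_eval dirac_image a = alg_eval dirac_image b"
proof (induction rule: dirac_rel.induct)
  case (1 \<mu> \<nu>)
  show ?case
    using exhaust_4_zero[of \<mu>] exhaust_4_zero[of \<nu>]
    by (elim disjE)
      (simp_all add: anticommutator_def minkowski_def cl33_normalize scaleR_2)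
next
  case (2 \<mu>)
  show ?case
    using exhaust_4_zero[of \<mu>]
    by (elim disjE) (simp_all add: commutator_def cl33_normalize)
next
  case (3 \<mu>)
  show ?case
    using exhaust_4_zero[of \<mu>]
    by (elim disjE) (simp_all add: anticommutator_def cl33_normalize)
qed (simp_all add: anticommutator_def cl33_normalize)

section \<open>The homomorphism given by the Clifford generators and its inverse\<close>

lemma clifford_hom_exists:
  obtains \<phi> where "real_algebra_hom \<phi>" "clifford_gens_map \<phi>"
proof -
  obtain \<phi> where "real_algebra_hom \<phi>" "\<And>g. \<phi> (abs_cl33 (Gen g)) = cl33_image g"
    using cl33_hom_exists[OF cl33_image_rel] by blast
  then show thesis
    using that[of \<phi>] by (simp add: clifford_gens_map_def cl33_pos.abs_eq cl33_neg.abs_eq)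
qed

lemma clifford_hom_unique:
  assumes "real_algebra_hom \<phi>" "clifford_gens_map \<phi>" "real_algebra_hom \<phi>'" "clifford_gens_map \<phi>'"
  shows "\<phi> = \<phi>'"
  using assms(2,4) by (intro cl33_hom_unique assms(1,3)) (simp_all add: clifford_gens_map_def)

lemma clifford_hom_iso:
  assumes hom: "real_algebra_hom \<phi>" and gens: "clifford_gens_map \<phi>"
  shows "real_algebra_iso \<phi>"
proof -
  obtain \<psi> where \<psi>: "real_algebra_hom \<psi>" "\<And>g. \<psi> (abs_dirac (Gen g)) = dirac_image g"
    using dirac_hom_exists[OF dirac_image_rel] by blast
  have \<psi>_gens: "\<psi> (gamma \<mu>) = dirac_image (DGamma \<mu>)" "\<psi> dirac_i = dirac_image DI"
    "\<psi> dirac_C = dirac_image DC" for \<mu>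
    by (simp_all add: gamma.abs_eq dirac_i.abs_eq dirac_C.abs_eq \<psi>(2))
  note \<phi>_gens = gens[unfolded clifford_gens_map_def]
  \<comment> \<open>The third positive generator returns as \<open>-(p\<^sub>1 p\<^sub>2)\<^sup>2
    p\<^sub>3 (n\<^sub>1 n\<^sub>2 n\<^sub>3)\<^sup>2\<close>, where the first square is -1 and the
    last is 1.\<close>
  have "(\<lambda>x. \<psi> (\<phi> x)) = (\<lambda>x. x)"
    by (rule cl33_hom_unique[OF real_algebra_hom_compose[OF hom \<psi>(1)] real_algebra_hom_id])
      (simp_all add: \<phi>_gens beta_defs \<psi>_gens real_algebra_homD[OF \<psi>(1)] cl33_normalize)
  moreover have "(\<lambda>x. \<phi> (\<psi> x)) = (\<lambda>x. x)"
    by (rule dirac_hom_unique[OF real_algebra_hom_compose[OF \<psi>(1) hom] real_algebra_hom_id])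
      (simp_all add: \<phi>_gens beta_defs \<psi>_gens real_algebra_homD[OF hom] dirac_normalize)
  ultimately have "bij \<phi>"
    by (intro o_bij[of \<psi>]) (simp_all add: fun_eq_iff)
  then show ?thesis
    using hom by (simp add: real_algebra_iso_def)
qed

theorem theorem1:
  shows "(\<exists>\<phi> :: cl33 \<Rightarrow> dirac. real_algebra_iso \<phi>) \<and>
    (\<exists>!\<phi> :: cl33 \<Rightarrow> dirac. real_algebra_hom \<phi> \<and> clifford_gens_map \<phi>) \<and>
    (\<forall>\<phi> :: cl33 \<Rightarrow> dirac. real_algebra_hom \<phi> \<and> clifford_gens_map \<phi> \<longrightarrow> real_algebra_iso \<phi>)"
  by (metis clifford_hom_exists clifford_hom_iso clifford_hom_unique)

end
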